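(* Let $\alpha>2$, $\beta\ge 1$, $\epsilon>0$ and let $k$ be a positive integer. There exists a constant $d$ (a positive integer), depending only on $\alpha$, $\beta$, $\epsilon$ and $k$, with the following property. Consider any SINR network with path loss exponent $\alpha$, threshold $\beta$ and sensitivity $\epsilon$ in which all stations have the same transmission power $P$ and the same range $r$. Let $0<x\le \frac{r}{\sqrt 2}$, and let $W$ be the set of stations, where at most $k$ stations of $W$ in any single grid box of the grid $G_x$ want to transmit (only stations that want to transmit may transmit). Let $u$ and $v$ be two stations in different grid boxes of $G_x$ such that $d(u,v)=\sqrt2\,x$ and $\sqrt2\,x$ is the minimum distance between any two stations lying in different grid boxes of $G_x$. Let $A_u$ be the set of (other) stations in $u$'s grid box. If $u$ is transmitting in a round $t$, and no other station in $u$'s box or in a box at box-distance less than $d$ from $u$'s box is transmitting in round $t$, then $v$ and all stations in $A_u$ hear (successfully receive) the message from $u$ in round $t$.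
   Context: SINR network. There are finitely many stations (nodes) located at distinct points of the Euclidean plane, and $d(\cdot,\cdot)$ applied to two stations denotes their Euclidean distance (not to be confused with the constant $d$). Fixed model parameters are the path loss exponent $\alpha$, the threshold $\beta\ge1$, the ambient noise $\mathcal N\ge 0$ and the sensitivity $\epsilon>0$. All stations have the same transmission power $P>0$. Time proceeds in synchronous rounds; in each round a station is either a transmitter or a receiver, not both. If $\mathcal T$ is the set of stations transmitting in a round, then for $u\in\mathcal T$ and a station $v\notin\mathcal T$, $$SINR(u,v,\mathcal T)=\frac{P/d(u,v)^\alpha}{\mathcal N+\sum_{i\in\mathcal T\setminus\{u\}}P/d(i,v)^\alpha}.$$ Reception (weak devices). A receiver $v$ hears, i.e. successfully receives, the message of $u$ in the round if both $$SINR(u,v,\mathcal T)\ge\beta\qquad\text{and}\qquad \frac{P}{d(u,v)^\alpha}\ge(1+\epsilon)\beta\mathcal N .$$ Range. The range $r$ of a station is the maximum distance at which another station can successfully receive its message when no other station transmits, i.e. $r=\left(\frac{P}{(1+\epsilon)\beta\mathcal N}\right)^{1/\alpha}$ (so a finite range $r$ means $\mathcal N>0$). It is a standing assumption that the communication graph, in which two stations are adjacent iff their distance is at most $r$, is connected. Grid. For $x>0$, the grid $G_x$ partitions the plane into boxes $[ax,(a+1)x)\times[bx,(b+1)x)$, $a,b\in\mathbb Z$; such a box has grid coordinates $(a,b)$. Box-distance: boxes $(a_1,b_1)$ and $(a_2,b_2)$ are at box-distance $0$ if they intersect (their closures share a point); otherwise their box-distance is $\max(\min(|a_1-a_2-1|,|a_2-a_1-1|),\min(|b_1-b_2-1|,|b_2-b_1-1|))$.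 *)

theory Defs
  imports "HOL-Analysis.Analysis"
begin

text \<open>
  Stations sit at distinct points of the plane, so a station is identified with its position,
  an element of \<^typ>\<open>real ^ 2\<close>, and a network is a finite set of such points. The set of stations
  transmitting in a round is called \<open>T\<close>.
\<close>

definition sinr :: "real \<Rightarrow> real \<Rightarrow> real \<Rightarrow> (real ^ 2) set \<Rightarrow> real ^ 2 \<Rightarrow> real ^ 2 \<Rightarrow> real" where
  "sinr \<alpha> P N T u v =
     (P / dist u v powr \<alpha>) / (N + (\<Sum>i\<in>T - {u}. P / dist i v powr \<alpha>))"

text \<open>
  The third conjunct says that \<open>v\<close> acts as a receiver; the last one is the sensitivity condition
  of weak devices.
\<close>

definition hears ::
  "real \<Rightarrow> real \<Rightarrow> real \<Rightarrow> real \<Rightarrow> real \<Rightarrow> (real ^ 2) set \<Rightarrow> (real ^ 2) set \<Rightarrow> real ^ 2 \<Rightarrow> real ^ 2 \<Rightarrow> bool"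
where
  "hears \<alpha> \<beta> \<epsilon> P N W T v u \<longleftrightarrow>
     u \<in> T \<and> v \<in> W \<and> v \<notin> T \<and>
     sinr \<alpha> P N T u v \<ge> \<beta> \<and>
     P / dist u v powr \<alpha> \<ge> (1 + \<epsilon>) * \<beta> * N"

text \<open>Only meaningful for \<open>N > 0\<close>: the range is infinite for \<open>N = 0\<close>, but the term evaluates to \<open>0\<close>.\<close>

definition sinr_range :: "real \<Rightarrow> real \<Rightarrow> real \<Rightarrow> real \<Rightarrow> real \<Rightarrow> real" where
  "sinr_range \<alpha> \<beta> \<epsilon> P N = (P / ((1 + \<epsilon>) * \<beta> * N)) powr (1 / \<alpha>)"

lemma hears_alone_iff:
  assumes "\<alpha> > 0" "\<beta> \<ge> 1" "\<epsilon> > 0" "P > 0" "N > 0" "v \<in> W" "u \<noteq> v"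
  shows "hears \<alpha> \<beta> \<epsilon> P N W {u} v u \<longleftrightarrow> dist u v \<le> sinr_range \<alpha> \<beta> \<epsilon> P N"
proof -
  define D where "D = dist u v"
  define S where "S = P / D powr \<alpha>"
  define M where "M = (1 + \<epsilon>) * \<beta> * N"
  have D: "D > 0" and M: "M > 0" using assms by (auto simp: D_def M_def)
  have "\<beta> * N \<le> M" using assms by (simp add: M_def algebra_simps)
  then have "M \<le> S \<Longrightarrow> \<beta> \<le> S / N" using \<open>N > 0\<close> by (simp add: pos_le_divide_eq)
  moreover have "sinr \<alpha> P N {u} u v = S / N" by (simp add: sinr_def S_def D_def)
  ultimately have "hears \<alpha> \<beta> \<epsilon> P N W {u} v u \<longleftrightarrow> M \<le> S"
    using assms by (auto simp: hears_def S_def D_def M_def)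
  also have "\<dots> \<longleftrightarrow> D powr \<alpha> \<le> P / M"
    using D M by (simp add: S_def field_simps)
  also have "\<dots> \<longleftrightarrow> D \<le> (P / M) powr (1 / \<alpha>)"
  proof
    assume "D powr \<alpha> \<le> P / M"
    then have "(D powr \<alpha>) powr (1 / \<alpha>) \<le> (P / M) powr (1 / \<alpha>)"
      using assms by (intro powr_mono2) auto
    then show "D \<le> (P / M) powr (1 / \<alpha>)" using assms D by (simp add: powr_powr)
  next
    assume "D \<le> (P / M) powr (1 / \<alpha>)"
    then have "D powr \<alpha> \<le> ((P / M) powr (1 / \<alpha>)) powr \<alpha>"
      using assms D by (intro powr_mono2) auto
    then show "D powr \<alpha> \<le> P / M" using assms M by (simp add: powr_powr)
  qed
  finally show ?thesis by (simp add: D_def M_def sinr_range_def)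
qed

definition comm_graph :: "real \<Rightarrow> (real ^ 2) set \<Rightarrow> ((real ^ 2) \<times> (real ^ 2)) set" where
  "comm_graph r W = {(u, v). u \<in> W \<and> v \<in> W \<and> u \<noteq> v \<and> dist u v \<le> r}"

definition sinr_network :: "real \<Rightarrow> real \<Rightarrow> real \<Rightarrow> real \<Rightarrow> real \<Rightarrow> (real ^ 2) set \<Rightarrow> bool" where
  "sinr_network \<alpha> \<beta> \<epsilon> P N W \<longleftrightarrow>
     P > 0 \<and> N > 0 \<and> finite W \<and>
     (\<forall>u\<in>W. \<forall>v\<in>W. (u, v) \<in> (comm_graph (sinr_range \<alpha> \<beta> \<epsilon> P N) W)\<^sup>*)"

definition grid_box :: "real \<Rightarrow> int \<times> int \<Rightarrow> (real ^ 2) set" where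
  "grid_box x = (\<lambda>(a, b).
     {p. p $ 1 \<in> {of_int a * x ..< (of_int a + 1) * x} \<and>
         p $ 2 \<in> {of_int b * x ..< (of_int b + 1) * x}})"

definition box_dist :: "real \<Rightarrow> int \<times> int \<Rightarrow> int \<times> int \<Rightarrow> int" where
  "box_dist x = (\<lambda>(a1, b1) (a2, b2).
     if closure (grid_box x (a1, b1)) \<inter> closure (grid_box x (a2, b2)) \<noteq> {} then 0
     else max (min \<bar>a1 - a2 - 1\<bar> \<bar>a2 - a1 - 1\<bar>) (min \<bar>b1 - b2 - 1\<bar> \<bar>b2 - b1 - 1\<bar>))"

end

theory Submission
  imports Defs
begin

text \<open>
  Every listener is at distance at most \<open>sqrt 2 * x\<close> from \<open>u\<close>, hence within Chebyshev
  distance 2 of \<open>u\<close>'s box in grid coordinates. The boxes at Chebyshev distance \<open>m\<close> number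
  \<open>O(m)\<close>, and a station in one of them is at distance \<open>\<Omega>(m * x)\<close> from the listener, so the
  interference is at most a constant times \<open>P / x powr \<alpha>\<close> times the tail of the series of
  \<open>m powr (1 - \<alpha>)\<close> from \<open>d\<close> on. As \<open>\<alpha> > 2\<close>, the tail can be made small, whereas the
  sensitivity condition leaves the fraction \<open>\<epsilon> / (1 + \<epsilon>)\<close> of the received power as slack.
\<close>

definition box_of :: "real \<Rightarrow> real ^ 2 \<Rightarrow> int \<times> int" where
  "box_of x p = (\<lfloor>p $ 1 / x\<rfloor>, \<lfloor>p $ 2 / x\<rfloor>)"

text \<open>Estimates run through this metric because \<open>box_dist\<close> violates the triangle
  inequality: touching boxes are at box-distance 0.\<close>

definition cheb_dist :: "int \<times> int \<Rightarrow> int \<times> int \<Rightarrow> int" where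
  "cheb_dist c c' = max \<bar>fst c - fst c'\<bar> \<bar>snd c - snd c'\<bar>"

lemma cheb_dist_triangle: "cheb_dist a c \<le> cheb_dist a b + cheb_dist b c"
  by (auto simp: cheb_dist_def)

lemma in_grid_box_iff:
  assumes "x > 0"
  shows "p \<in> grid_box x c \<longleftrightarrow> c = box_of x p"
proof -
  have *: "y \<in> {of_int a * x ..< (of_int a + 1) * x} \<longleftrightarrow> a = \<lfloor>y / x\<rfloor>" for y a
    using assms by (auto simp: eq_commute[of a] floor_eq_iff pos_le_divide_eq pos_divide_less_eq)
  show ?thesis
    by (cases c) (simp only: grid_box_def box_of_def * split mem_Collect_eq prod.inject)
qed

text \<open>If e is the difference in one coordinate, the minimum in \<open>box_dist\<close> is ||e|
  - 1|, that is |e| - 1 unless e = 0, where it is 1. The lower cutoff 1 absorbs this exception and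
  the value 0 of touching boxes.\<close>

lemma box_dist_le: "box_dist x c c' \<le> max 1 (cheb_dist c c' - 1)"
  by (cases c; cases c') (auto simp: box_dist_def cheb_dist_def)

text \<open>Rounding both coordinates down changes their difference by less than 1, and a coordinate
  difference never exceeds the Euclidean distance.\<close>

lemma cheb_dist_le_dist:
  fixes x :: real
  assumes "x > 0"
  shows "(real_of_int (cheb_dist (box_of x p) (box_of x q)) - 1) * x \<le> dist p q"
proof -
  have *: "(real_of_int \<bar>\<lfloor>y / x\<rfloor> - \<lfloor>z / x\<rfloor>\<bar> - 1) * x \<le> \<bar>y - z\<bar>" for y z :: real
  proof -
    have "real_of_int \<bar>\<lfloor>y / x\<rfloor> - \<lfloor>z / x\<rfloor>\<bar> - 1 \<le> \<bar>y / x - z / x\<bar>" by linarith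
    also have "\<dots> = \<bar>y - z\<bar> / x"
      using assms by (simp flip: diff_divide_distrib add: abs_divide)
    finally show ?thesis using assms by (simp add: pos_le_divide_eq)
  qed
  have "\<bar>p $ i - q $ i\<bar> \<le> dist p q" for i
    using dist_vec_nth_le[of p i q] by (simp add: dist_real_def)
  then have "(real_of_int \<bar>\<lfloor>p $ i / x\<rfloor> - \<lfloor>q $ i / x\<rfloor>\<bar> - 1) * x \<le> dist p q" for i
    using * order_trans by blast
  then show ?thesis by (simp add: cheb_dist_def box_of_def max_def)
qed

text \<open>The bound is the diagonal of a box. It puts the stations of u's box within the same
  distance of u as v, so one argument serves all listeners.\<close>

lemma dist_le_same_box:
  assumes "x > 0" "box_of x p = box_of x q"
  shows "dist p q \<le> sqrt 2 * x"
proof -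
  have *: "\<bar>y - z\<bar> \<le> x" if "\<lfloor>y / x\<rfloor> = \<lfloor>z / x\<rfloor>" for y z
  proof -
    have "\<bar>y / x - z / x\<bar> \<le> 1" using that by linarith
    then show ?thesis
      using assms by (simp flip: diff_divide_distrib add: abs_divide)
  qed
  have "\<bar>p $ 1 - q $ 1\<bar> \<le> x" "\<bar>p $ 2 - q $ 2\<bar> \<le> x"
    using assms(2) by (auto simp: box_of_def intro!: *)
  then have "(p $ 1 - q $ 1)\<^sup>2 \<le> x\<^sup>2" "(p $ 2 - q $ 2)\<^sup>2 \<le> x\<^sup>2"
    using assms(1) by (simp_all add: abs_le_square_iff[symmetric])
  then have "dist p q \<le> sqrt (2 * x\<^sup>2)"
    by (simp add: dist_vec_def L2_set_def sum_2 dist_real_def)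
  also have "\<dots> = sqrt 2 * x" using assms(1) by (simp add: real_sqrt_mult)
  finally show ?thesis .
qed

text \<open>The shell is the boundary of a square: four sides of 2m + 1 boxes, corners counted
  twice, and 4(2m + 1) \<le> 12m once m \<ge> 1.\<close>

lemma cheb_shell:
  assumes "m > 0"
  shows "finite {c. cheb_dist c0 c = int m}" "card {c. cheb_dist c0 c = int m} \<le> 12 * m"
proof -
  define a b where "a = fst c0" and "b = snd c0"
  define A where "A = {a - int m, a + int m} \<times> {b - int m .. b + int m}"
  define B where "B = {a - int m .. a + int m} \<times> {b - int m, b + int m}"
  have sub: "{c. cheb_dist c0 c = int m} \<subseteq> A \<union> B"
    unfolding A_def B_def a_def b_def cheb_dist_def by auto
  have fin: "finite (A \<union> B)" by (simp add: A_def B_def)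
  have "card (A \<union> B) \<le> card A + card B" by (rule card_Un_le)
  also have "\<dots> \<le> 12 * m"
    using assms by (simp add: A_def B_def card_cartesian_product card_insert_if nat_add_distrib)
  finally show "card {c. cheb_dist c0 c = int m} \<le> 12 * m"
    using card_mono[OF fin sub] by linarith
  show "finite {c. cheb_dist c0 c = int m}" using finite_subset[OF sub fin] .
qed

lemma card_stations_in_shell:
  assumes "x > 0" "m > 0" "\<And>c. card (T \<inter> grid_box x c) \<le> k"
  shows "card {i\<in>T. cheb_dist c0 (box_of x i) = int m} \<le> 12 * m * k"
proof -
  let ?S = "{c. cheb_dist c0 c = int m}"
  have "{i\<in>T. cheb_dist c0 (box_of x i) = int m} = (\<Union>c\<in>?S. T \<inter> grid_box x c)"
    using assms(1) by (auto simp: in_grid_box_iff)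
  also have "card \<dots> \<le> (\<Sum>c\<in>?S. card (T \<inter> grid_box x c))"
    by (intro card_UN_le cheb_shell assms)
  also have "\<dots> \<le> card ?S * k" using assms(3) sum_bounded_above[of ?S _ k] by simp
  also have "\<dots> \<le> 12 * m * k" using cheb_shell[OF assms(2)] by (intro mult_right_mono) auto
  finally show ?thesis .
qed

text \<open>Group the stations by shell: shell m holds at most 12mk of them, each contributing at
  most (4 / (m x))^\<alpha>, which leaves m^(1 - \<alpha>). The witness \<open>n\<close> only has to
  exceed every occupied shell.\<close>

lemma path_loss_sum_le:
  fixes \<alpha> x :: real and d k :: nat
  assumes "\<alpha> > 0" "x > 0" "d \<ge> 4"
    and fin: "finite T"
    and dens: "\<And>c. card (T \<inter> grid_box x c) \<le> k"
    and near: "cheb_dist c0 (box_of x w) \<le> 2"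
    and far: "\<And>i. i \<in> T \<Longrightarrow> int d \<le> cheb_dist c0 (box_of x i)"
  shows "\<exists>n. (\<Sum>i\<in>T. 1 / dist i w powr \<alpha>)
      \<le> 12 * real k * (4 / x) powr \<alpha> * (\<Sum>m=d..<n. real m powr (1 - \<alpha>))"
proof -
  define h where "h i = nat (cheb_dist c0 (box_of x i))" for i
  have h: "cheb_dist c0 (box_of x i) = int (h i)" for i
    by (simp add: h_def cheb_dist_def le_max_iff_disj)
  have shell: "(\<Sum>i\<in>{i\<in>T. h i = m}. 1 / dist i w powr \<alpha>)
      \<le> 12 * real k * (4 / x) powr \<alpha> * real m powr (1 - \<alpha>)" if "m \<ge> d" for m
  proof -
    have m: "m \<ge> 4" using that assms by simp
    have "1 / dist i w powr \<alpha> \<le> (4 / x) powr \<alpha> * real m powr - \<alpha>" if "i \<in> T" "h i = m" for i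
    proof -
      have "int m \<le> 2 + cheb_dist (box_of x w) (box_of x i)"
        using cheb_dist_triangle[of c0 "box_of x i" "box_of x w"] near h[of i] that by simp
      \<comment> \<open>Passing from \<open>c0\<close> to the box of \<open>w\<close> costs 2 and
        rounding costs 1; m - 3 \<ge> m / 4 holds exactly from m = 4 on.\<close>
      then have "real m / 4 \<le> real_of_int (cheb_dist (box_of x w) (box_of x i)) - 1" using m by linarith
      then have "real m / 4 * x \<le> (real_of_int (cheb_dist (box_of x w) (box_of x i)) - 1) * x"
        using assms by (intro mult_right_mono) auto
      also have "\<dots> \<le> dist w i" using assms by (intro cheb_dist_le_dist)
      finally have le: "real m / 4 * x \<le> dist i w" by (simp add: dist_commute)
      have pos: "0 < real m / 4 * x" using m assms by simp
      have "1 / dist i w powr \<alpha> \<le> 1 / (real m / 4 * x) powr \<alpha>"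
        using le m order.strict_trans2[OF pos le] assms
        by (intro divide_left_mono powr_mono2 mult_pos_pos) (simp_all del: times_divide_eq_left)
      also have "\<dots> = (4 / x) powr \<alpha> * real m powr - \<alpha>"
        using m assms by (simp add: powr_mult powr_divide powr_minus field_simps)
      finally show ?thesis .
    qed
    then have "(\<Sum>i\<in>{i\<in>T. h i = m}. 1 / dist i w powr \<alpha>)
        \<le> real (card {i\<in>T. h i = m}) * ((4 / x) powr \<alpha> * real m powr - \<alpha>)"
      by (intro sum_bounded_above) auto
    also have "\<dots> \<le> real (12 * m * k) * ((4 / x) powr \<alpha> * real m powr - \<alpha>)"
      using card_stations_in_shell[of x m T k c0] assms m
      by (intro mult_right_mono of_nat_mono) (auto simp: h)
    also have "\<dots> = 12 * real k * (4 / x) powr \<alpha> * real m powr (1 - \<alpha>)"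
      using m by (simp add: powr_diff powr_minus field_simps)
    finally show ?thesis .
  qed
  \<comment> \<open>If \<open>T\<close> is empty, \<open>Max\<close> is unspecified, but the
    inclusion is then trivial.\<close>
  have range: "h ` T \<subseteq> {d..<Suc (Max (h ` T))}"
    using fin far by (auto simp: h less_Suc_eq_le)
  have "(\<Sum>i\<in>T. 1 / dist i w powr \<alpha>) = (\<Sum>m\<in>h ` T. \<Sum>i\<in>{i\<in>T. h i = m}. 1 / dist i w powr \<alpha>)"
    by (rule sum.image_gen[OF fin])
  also have "\<dots> \<le> (\<Sum>m\<in>h ` T. 12 * real k * (4 / x) powr \<alpha> * real m powr (1 - \<alpha>))"
    using range by (intro sum_mono shell) auto
  also have "\<dots> \<le> (\<Sum>m=d..<Suc (Max (h ` T)). 12 * real k * (4 / x) powr \<alpha> * real m powr (1 - \<alpha>))"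
    using range by (intro sum_mono2) auto
  finally show ?thesis unfolding sum_distrib_left[symmetric] by blast
qed

text \<open>Here \<alpha> > 2 enters: the exponent 1 - \<alpha> is below -1, so the series
  converges. The Cauchy criterion bounds its finite segments uniformly in \<open>n\<close>.\<close>

lemma powr_tail_small:
  fixes \<alpha> \<delta> :: real
  assumes "\<alpha> > 2" "\<delta> > 0"
  obtains d where "\<And>d' n. d' \<ge> d \<Longrightarrow> (\<Sum>m=d'..<n. real m powr (1 - \<alpha>)) < \<delta>"
proof -
  have "summable (\<lambda>m. real m powr (1 - \<alpha>))" using assms by (simp add: summable_real_powr_iff)
  then obtain d where "\<And>m n. m \<ge> d \<Longrightarrow> norm (\<Sum>i=m..<n. real i powr (1 - \<alpha>)) < \<delta>"
    using assms(2) unfolding summable_Cauchy by blast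
  then show thesis by (intro that) (force simp: abs_less_iff)
qed

lemma hears_if_low_interference:
  assumes "\<alpha> > 0" "\<beta> \<ge> 1" "\<epsilon> > 0" "P > 0" "N > 0" "u \<in> T" "w \<in> W" "w \<notin> T"
    and range: "dist u w \<le> sinr_range \<alpha> \<beta> \<epsilon> P N"
    and interf: "\<beta> * (\<Sum>i\<in>T - {u}. P / dist i w powr \<alpha>) \<le> \<epsilon> / (1 + \<epsilon>) * (P / dist u w powr \<alpha>)"
  shows "hears \<alpha> \<beta> \<epsilon> P N W T w u"
proof -
  define S I where "S = P / dist u w powr \<alpha>" and "I = (\<Sum>i\<in>T - {u}. P / dist i w powr \<alpha>)"
  have "u \<noteq> w" using assms by auto
  \<comment> \<open>Being in range means being heard when alone, and this includes the sensitivity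
    condition.\<close>
  then have "hears \<alpha> \<beta> \<epsilon> P N W {u} w u" using hears_alone_iff assms by blast
  then have sens: "S \<ge> (1 + \<epsilon>) * \<beta> * N" by (simp add: hears_def S_def)
  have "I \<ge> 0" unfolding I_def using assms by (intro sum_nonneg) auto
  \<comment> \<open>Noise uses at most the fraction 1 / (1 + \<epsilon>) of the signal; the rest is
    available for interference.\<close>
  have "\<beta> * N \<le> S / (1 + \<epsilon>)" using sens assms by (simp add: pos_le_divide_eq mult_ac)
  moreover have "S / (1 + \<epsilon>) + \<epsilon> / (1 + \<epsilon>) * S = S"
  proof -
    have "\<epsilon> / (1 + \<epsilon>) = 1 - 1 / (1 + \<epsilon>)" using \<open>\<epsilon> > 0\<close> by (simp add: field_simps)
    then show ?thesis by (simp add: left_diff_distrib)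
  qed
  ultimately have "\<beta> * (N + I) \<le> S"
    using interf by (simp add: S_def[symmetric] I_def[symmetric] algebra_simps)
  then have "\<beta> \<le> S / (N + I)" using assms \<open>I \<ge> 0\<close> by (simp add: pos_le_divide_eq)
  with sens assms show ?thesis by (simp add: hears_def sinr_def S_def I_def)
qed

theorem lemma2:
  fixes \<alpha> \<beta> \<epsilon> :: real and k :: nat
  assumes "\<alpha> > 2" and "\<beta> \<ge> 1" and "\<epsilon> > 0" and "k > 0"
  shows "\<exists>d :: nat. d > 0 \<and>
    (\<forall>(P :: real) (N :: real) (x :: real) (W :: (real ^ 2) set) (want :: (real ^ 2) set)
      (transmitters :: nat \<Rightarrow> (real ^ 2) set) (t :: nat)
      (u :: real ^ 2) (v :: real ^ 2) (cu :: int \<times> int) (cv :: int \<times> int).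
      sinr_network \<alpha> \<beta> \<epsilon> P N W \<longrightarrow>
      0 < x \<longrightarrow> x \<le> sinr_range \<alpha> \<beta> \<epsilon> P N / sqrt 2 \<longrightarrow>
      want \<subseteq> W \<longrightarrow>
      (\<forall>c. card (want \<inter> grid_box x c) \<le> k) \<longrightarrow>
      (\<forall>s. transmitters s \<subseteq> want) \<longrightarrow>
      u \<in> W \<longrightarrow> u \<in> grid_box x cu \<longrightarrow>
      v \<in> W \<longrightarrow> v \<in> grid_box x cv \<longrightarrow>
      cu \<noteq> cv \<longrightarrow>
      dist u v = sqrt 2 * x \<longrightarrow>
      (\<forall>p\<in>W. \<forall>q\<in>W. \<forall>c c'. p \<in> grid_box x c \<and> q \<in> grid_box x c' \<and> c \<noteq> c'
         \<longrightarrow> sqrt 2 * x \<le> dist p q) \<longrightarrow>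
      u \<in> transmitters t \<longrightarrow>
      (\<forall>w\<in>transmitters t. \<forall>c. w \<noteq> u \<and> w \<in> grid_box x c
         \<longrightarrow> c \<noteq> cu \<and> \<not> box_dist x cu c < int d) \<longrightarrow>
      hears \<alpha> \<beta> \<epsilon> P N W (transmitters t) v u \<and>
      (\<forall>w \<in> (W \<inter> grid_box x cu) - {u}. hears \<alpha> \<beta> \<epsilon> P N W (transmitters t) w u))"
proof -
  \<comment> \<open>\<open>C\<close> times the tail bounds \<beta> times the interference, measured
    in units of the signal power at distance sqrt 2 * x. The factor sqrt 2 powr \<alpha> comes from
    this unit, in which \<open>x\<close> and \<open>P\<close> cancel, so that \<open>d\<close>
    depends on neither.\<close>
  define C where "C = \<beta> * (12 * real k * 4 powr \<alpha> * sqrt 2 powr \<alpha>)"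
  have "C > 0" using assms by (simp add: C_def)
  then obtain d0 where d0: "\<And>d n. d \<ge> d0 \<Longrightarrow> (\<Sum>m=d..<n. real m powr (1 - \<alpha>)) < \<epsilon> / (1 + \<epsilon>) / C"
    using powr_tail_small[OF assms(1), of "\<epsilon> / (1 + \<epsilon>) / C"] assms
    by (metis divide_pos_pos add_pos_pos zero_less_one)
  define d where "d = max 4 d0"
  have key: "hears \<alpha> \<beta> \<epsilon> P N W T w u"
    if net: "sinr_network \<alpha> \<beta> \<epsilon> P N W" and x: "0 < x" "x \<le> sinr_range \<alpha> \<beta> \<epsilon> P N / sqrt 2"
      and T: "T \<subseteq> W" "u \<in> T" and dens: "\<And>c. card (T \<inter> grid_box x c) \<le> k"
      and silent: "\<And>i. i \<in> T - {u} \<Longrightarrow> \<not> box_dist x (box_of x u) (box_of x i) < int d"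
      and w: "w \<in> W" "w \<noteq> u" "dist u w \<le> sqrt 2 * x"
    for P N x W T u w
  proof -
    have P: "P > 0" "N > 0" and fin: "finite T"
      using net T finite_subset by (auto simp: sinr_network_def)
    have far: "int d \<le> cheb_dist (box_of x u) (box_of x i)" if "i \<in> T - {u}" for i
      using silent[OF that] box_dist_le[of x "box_of x u" "box_of x i"] by (simp add: d_def)
    have "sqrt 2 < (2 :: real)" by (simp add: real_less_lsqrt)
    then have "sqrt 2 * x < 2 * x" using x by simp
    then have "(real_of_int (cheb_dist (box_of x u) (box_of x w)) - 1) * x < 2 * x"
      using cheb_dist_le_dist[OF x(1), of u w] w by linarith
    \<comment> \<open>Integrality: the Chebyshev distance is below 3.\<close>
    then have near: "cheb_dist (box_of x u) (box_of x w) \<le> 2" using x by simp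
    \<comment> \<open>A transmitting \<open>w\<close> would be at Chebyshev distance at least 4 by
      \<open>far\<close>, against \<open>near\<close>.\<close>
    have wT: "w \<notin> T" using far[of w] near w by (auto simp: d_def)
    have range: "dist u w \<le> sinr_range \<alpha> \<beta> \<epsilon> P N"
      using w x by (simp add: pos_le_divide_eq mult.commute)
    have "card ((T - {u}) \<inter> grid_box x c) \<le> k" for c
      using dens[of c] fin card_mono[of "T \<inter> grid_box x c" "(T - {u}) \<inter> grid_box x c"] by force
    then obtain n where n: "(\<Sum>i\<in>T - {u}. 1 / dist i w powr \<alpha>)
        \<le> 12 * real k * (4 / x) powr \<alpha> * (\<Sum>m=d..<n. real m powr (1 - \<alpha>))"
      using path_loss_sum_le[of \<alpha> x d "T - {u}" k "box_of x u" w] assms x fin near far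
      by (auto simp: d_def)
    let ?tail = "\<Sum>m=d..<n. real m powr (1 - \<alpha>)"
    have "?tail < \<epsilon> / (1 + \<epsilon>) / C" by (rule d0) (simp add: d_def)
    then have tail: "C * ?tail \<le> \<epsilon> / (1 + \<epsilon>)"
      unfolding pos_less_divide_eq[OF \<open>C > 0\<close>] by (simp only: mult.commute less_imp_le)
    have "\<beta> * (\<Sum>i\<in>T - {u}. P / dist i w powr \<alpha>) = \<beta> * P * (\<Sum>i\<in>T - {u}. 1 / dist i w powr \<alpha>)"
      by (simp add: sum_distrib_left mult_ac)
    also have "\<dots> \<le> \<beta> * P * (12 * real k * (4 / x) powr \<alpha> * ?tail)"
      using n assms P by (intro mult_left_mono) auto
    also have "\<dots> = C * ?tail * (P / (sqrt 2 * x) powr \<alpha>)"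
      using x by (simp add: C_def powr_mult powr_divide field_simps)
    also have "\<dots> \<le> \<epsilon> / (1 + \<epsilon>) * (P / (sqrt 2 * x) powr \<alpha>)"
      using tail P by (intro mult_right_mono) auto
    \<comment> \<open>The signal of \<open>u\<close> at \<open>w\<close> is at least that at the
      maximal distance sqrt 2 * x.\<close>
    also have "\<dots> \<le> \<epsilon> / (1 + \<epsilon>) * (P / dist u w powr \<alpha>)"
      using w x P assms by (intro mult_left_mono divide_left_mono powr_mono2 mult_pos_pos) auto
    finally show ?thesis
      using assms P T w wT range by (intro hears_if_low_interference) auto
  qed
  show ?thesis
  proof (intro exI[of _ d] conjI allI impI ballI)
    show "d > 0" by (simp add: d_def)
  next
    fix P N x :: real and W want :: "(real ^ 2) set" and transmitters :: "nat \<Rightarrow> (real ^ 2) set"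
      and t :: nat and u v :: "real ^ 2" and cu cv :: "int \<times> int"
    assume net: "sinr_network \<alpha> \<beta> \<epsilon> P N W"
      and x: "0 < x" "x \<le> sinr_range \<alpha> \<beta> \<epsilon> P N / sqrt 2"
      and want: "want \<subseteq> W" "\<forall>c. card (want \<inter> grid_box x c) \<le> k" "\<forall>s. transmitters s \<subseteq> want"
      and u: "u \<in> grid_box x cu" "u \<in> transmitters t"
      and v: "v \<in> W" "v \<in> grid_box x cv" "cu \<noteq> cv" "dist u v = sqrt 2 * x"
      and silent: "\<forall>w\<in>transmitters t. \<forall>c. w \<noteq> u \<and> w \<in> grid_box x c
         \<longrightarrow> c \<noteq> cu \<and> \<not> box_dist x cu c < int d"
    have "finite want" using net want finite_subset by (auto simp: sinr_network_def)
    then have "card (transmitters t \<inter> grid_box x c) \<le> card (want \<inter> grid_box x c)" for c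
      using want by (intro card_mono) auto
    then have dens: "card (transmitters t \<inter> grid_box x c) \<le> k" for c
      using want order_trans by blast
    have cu: "cu = box_of x u" using u x in_grid_box_iff by blast
    have hears: "hears \<alpha> \<beta> \<epsilon> P N W (transmitters t) w u"
      if "w \<in> W" "w \<noteq> u" "dist u w \<le> sqrt 2 * x" for w
      using key[OF net x order_trans[OF spec[OF want(3)] want(1)], of u t w] u dens silent that cu
      by (auto simp: in_grid_box_iff[OF x(1)])
    show "hears \<alpha> \<beta> \<epsilon> P N W (transmitters t) v u"
      using v x by (intro hears) auto
    show "hears \<alpha> \<beta> \<epsilon> P N W (transmitters t) w u" if "w \<in> W \<inter> grid_box x cu - {u}" for w
      using that x cu by (intro hears dist_le_same_box) (auto simp: in_grid_box_iff)
  qed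
qed

end
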